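(* For every integer $t\geq 2$, if $G$ is an $n$-vertex triangle-free $K_{2,t}$-free graph with diameter $2$, and $G$ is not a star graph, then $G$ has minimum degree at least $(1+o(1))\frac{1}{(t-1)^2}\sqrt{n}$ and at most $(1+o(1))\sqrt{tn}$, and $G$ has maximum degree at least $\sqrt{n-1}$.
   Context: All graphs are finite, simple and undirected. A graph is $H$-free if it contains no (not necessarily induced) subgraph isomorphic to $H$; triangle-free means $K_3$-free. A graph has diameter $2$ if it is connected and the maximum distance between two of its vertices is exactly $2$. A star graph is a graph isomorphic to $K_{1,m}$ for some $m\geq 1$. The $o(1)$ terms are for fixed $t$ as $n\to\infty$, and are uniform over all graphs $G$ as in the claim: that is, for each fixed $t$ and each $\varepsilon>0$ there is $N$ such that every such $G$ with $n\geq N$ vertices has minimum degree at least $(1-\varepsilon)\frac{1}{(t-1)^2}\sqrt{n}$ and at most $(1+\varepsilon)\sqrt{tn}$. The maximum degree bound holds for all $n$. *)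

theory Defs
  imports Complex_Main "Graph_Theory.Graph_Theory"
begin

text \<open>
  A finite simple undirected graph is a symmetric loop-free digraph without parallel arcs:
  \<^term>\<open>pair_graph G\<close>, where every edge \<open>uv\<close> is represented by the two arcs
  \<open>(u, v)\<close> and \<open>(v, u)\<close>.
\<close>

text \<open>
  The graph \<open>H\<close> to be excluded is given by its isomorphism class \<open>P\<close>, such as
  \<^term>\<open>complete_digraph n\<close> or \<^term>\<open>complete_bipartite_digraph m n\<close>; the subgraph
  need not be induced.
\<close>

definition subgraph_free ::
  "(('a, 'b) pre_digraph \<Rightarrow> bool) \<Rightarrow> ('a, 'b) pre_digraph \<Rightarrow> bool" where
  "subgraph_free P G \<longleftrightarrow> \<not> (\<exists>H. subgraph H G \<and> P H)"

definition star_graph :: "('a, 'b) pre_digraph \<Rightarrow> bool" where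
  "star_graph G \<longleftrightarrow> (\<exists>m\<ge>1. complete_bipartite_digraph 1 m G)"

text \<open>The minimum number of arcs of a walk, being the least cost for unit weights.\<close>

definition graph_dist :: "('a, 'b) pre_digraph \<Rightarrow> 'a \<Rightarrow> 'a \<Rightarrow> ereal" where
  "graph_dist G u v = wf_digraph.\<mu> G (\<lambda>_. 1) u v"

text \<open>For a finite graph with a vertex the supremum is a maximum.\<close>

definition diameter :: "('a, 'b) pre_digraph \<Rightarrow> ereal" where
  "diameter G = (SUP (u, v) \<in> verts G \<times> verts G. graph_dist G u v)"

definition has_diameter_two :: "('a, 'b) pre_digraph \<Rightarrow> bool" where
  "has_diameter_two G \<longleftrightarrow> Digraph_Component.connected G \<and> diameter G = 2"

text \<open>
  In a symmetric digraph the out-degree of a vertex is its number of neighbours.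
  Both definitions below are meant for finite graphs with at least one vertex.
\<close>

definition min_degree :: "('a, 'b) pre_digraph \<Rightarrow> nat" where
  "min_degree G = Min (out_degree G ` verts G)"

definition max_degree :: "('a, 'b) pre_digraph \<Rightarrow> nat" where
  "max_degree G = Max (out_degree G ` verts G)"

end

(*
  Two non-adjacent vertices u, v have at least one and at most t - 1 common neighbours, and every
  neighbour of u either is adjacent to v or shares a neighbour x of v with v, where x has at most
  t - 1 neighbours in N(u). Hence deg u <= (t - 1) deg v. If u, v are adjacent and some w is
  adjacent to neither, applying this twice gives deg u <= (t - 1)^2 deg v; otherwise the graph is
  complete bipartite, so a star or of order at most 2 (t - 1). Thus all degrees of a large graph
  are within a factor (t - 1)^2, and the Moore bound n <= 1 + Delta^2 yields the lower bound on the
  minimum degree. The upper bound counts paths with two edges starting at a fixed vertex.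
*)
theory Submission
  imports Defs
begin

section \<open>Neighbourhoods and degrees of a symmetric digraph\<close>

definition nbrs :: "'a pair_pre_digraph \<Rightarrow> 'a \<Rightarrow> 'a set" where
  "nbrs G v = {w. (v, w) \<in> parcs G}"

context pair_graph
begin

lemma nbrs_sym: "w \<in> nbrs G v \<longleftrightarrow> v \<in> nbrs G w"
  using arcs_symmetric by (auto simp: nbrs_def)

lemma nbrs_irrefl: "v \<notin> nbrs G v"
  using pair_no_loops[of "(v, v)"] by (auto simp: nbrs_def)

lemma nbrs_subset: "nbrs G v \<subseteq> pverts G"
  using in_arcsD2 by (auto simp: nbrs_def)

lemma finite_nbrs: "finite (nbrs G v)"
  using nbrs_subset pair_finite_verts by (rule finite_subset)

lemma out_degree_eq_card_nbrs: "out_degree (with_proj G) v = card (nbrs G v)"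
proof -
  have "out_arcs (with_proj G) v = Pair v ` nbrs G v"
    by (auto simp: out_arcs_def nbrs_def)
  then show ?thesis
    by (simp add: out_degree_def card_image inj_on_def)
qed

lemma card_nbrs_le_max_degree:
  assumes "v \<in> pverts G"
  shows "card (nbrs G v) \<le> max_degree (with_proj G)"
  using assms pair_finite_verts
  by (auto simp: max_degree_def simp flip: out_degree_eq_card_nbrs intro!: Max_ge)

lemma min_degree_le_card_nbrs:
  assumes "v \<in> pverts G"
  shows "min_degree (with_proj G) \<le> card (nbrs G v)"
  using assms pair_finite_verts
  by (auto simp: min_degree_def simp flip: out_degree_eq_card_nbrs intro!: Min_le)

lemma obtain_max_degree_vertex:
  assumes "pverts G \<noteq> {}"
  obtains v where "v \<in> pverts G" "card (nbrs G v) = max_degree (with_proj G)"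
proof -
  have "Max (out_degree (with_proj G) ` pverts G) \<in> out_degree (with_proj G) ` pverts G"
    using assms pair_finite_verts by (intro Max_in) auto
  with that show thesis
    by (auto simp: max_degree_def out_degree_eq_card_nbrs)
qed

lemma obtain_min_degree_vertex:
  assumes "pverts G \<noteq> {}"
  obtains v where "v \<in> pverts G" "card (nbrs G v) = min_degree (with_proj G)"
proof -
  have "Min (out_degree (with_proj G) ` pverts G) \<in> out_degree (with_proj G) ` pverts G"
    using assms pair_finite_verts by (intro Min_in) auto
  with that show thesis
    by (auto simp: min_degree_def out_degree_eq_card_nbrs)
qed

section \<open>The excluded subgraphs and the diameter in terms of neighbourhoods\<close>

lemma subgraph_with_projI:
  assumes "pverts H \<subseteq> pverts G" "parcs H \<subseteq> parcs G" "wf_digraph (with_proj H)"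
  shows "subgraph (with_proj H) (with_proj G)"
  using assms wf_digraph_axioms by (auto simp: subgraph_def compatible_def)

lemma not_triangle:
  assumes "subgraph_free (complete_digraph 3) (with_proj G)"
    and "v \<in> nbrs G u" "w \<in> nbrs G u" "w \<in> nbrs G v"
  shows False
proof -
  define H where "H = \<lparr>pverts = {u, v, w},
    parcs = {(a, b). a \<in> {u, v, w} \<and> b \<in> {u, v, w} \<and> a \<noteq> b}\<rparr>"
  have sym: "u \<in> nbrs G v" "u \<in> nbrs G w" "v \<in> nbrs G w"
    using assms nbrs_sym by blast+
  have "u \<noteq> v" "u \<noteq> w" "v \<noteq> w"
    using assms nbrs_irrefl by blast+
  then have K: "complete_digraph 3 (with_proj H)"
    by (auto simp: complete_digraph_pair_def H_def)
  then have "wf_digraph (with_proj H)"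
    by (auto simp: complete_digraph_def graph_def digraph_def fin_digraph_def)
  moreover have "pverts H \<subseteq> pverts G" "parcs H \<subseteq> parcs G"
    using assms(2-) sym nbrs_subset by (auto simp: H_def nbrs_def)
  ultimately have "subgraph (with_proj H) (with_proj G)"
    by (intro subgraph_with_projI)
  with K assms(1) show False
    by (auto simp: subgraph_free_def)
qed

lemma card_common_nbrs_less:
  assumes free: "subgraph_free (complete_bipartite_digraph 2 t) (with_proj G)"
    and "u \<noteq> v" "u \<in> pverts G" "v \<in> pverts G"
  shows "card (nbrs G u \<inter> nbrs G v) < t"
proof (rule ccontr)
  assume "\<not> ?thesis"
  then obtain S where S: "S \<subseteq> nbrs G u \<inter> nbrs G v" "card S = t" "finite S"
    using obtain_subset_with_card_n[of t "nbrs G u \<inter> nbrs G v"] by (metis linorder_not_less)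
  \<comment> \<open>Only the arcs between \<open>{u, v}\<close> and \<open>S\<close> are kept, so
    that \<open>H\<close> is bipartite whatever other edges these vertices span.\<close>
  define H where "H = \<lparr>pverts = {u, v} \<union> S, parcs = {u, v} \<times> S \<union> S \<times> {u, v}\<rparr>"
  have "{u, v} \<inter> S = {}"
    using S(1) nbrs_irrefl by blast
  then have K: "complete_bipartite_digraph 2 t (with_proj H)"
    unfolding complete_bipartite_digraph_pair_def using S \<open>u \<noteq> v\<close>
    by (intro conjI exI[of _ "{u, v}"] exI[of _ S]) (auto simp: H_def)
  then have "wf_digraph (with_proj H)"
    by (auto simp: complete_bipartite_digraph_def graph_def digraph_def fin_digraph_def)
  moreover have "pverts H \<subseteq> pverts G"
    using assms S nbrs_subset by (auto simp: H_def)
  moreover have "parcs H \<subseteq> parcs G"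
    using S arcs_symmetric by (auto simp: H_def nbrs_def)
  ultimately have "subgraph (with_proj H) (with_proj G)"
    by (intro subgraph_with_projI)
  with K free show False
    by (auto simp: subgraph_free_def)
qed

text \<open>Diameter two yields a walk of at most two arcs from \<open>u\<close> to
  \<open>v\<close>. Distinctness excludes length 0 and non-adjacency length 1, so the walk has a
  middle vertex.\<close>

lemma obtain_common_nbr:
  assumes "has_diameter_two (with_proj G)"
    and "u \<in> pverts G" "v \<in> pverts G" "u \<noteq> v" "v \<notin> nbrs G u"
  obtains w where "w \<in> nbrs G u" "w \<in> nbrs G v"
proof -
  have "graph_dist (with_proj G) u v \<le> 2"
    using assms(1-3) SUP_upper[of "(u, v)" "pverts G \<times> pverts G"
        "\<lambda>(u, v). graph_dist (with_proj G) u v"]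
    by (simp add: has_diameter_two_def diameter_def)
  \<comment> \<open>The distance is an infimum over walks, and a strict bound on it yields a walk
    with cost below 3. Costs are lengths, hence integers, so this walk has at most two arcs.\<close>
  then have "\<mu> (\<lambda>_. 1) u v < 3"
    unfolding graph_dist_def by (rule le_less_trans) simp
  then obtain p where p: "awalk u p v" "ereal (awalk_cost (\<lambda>_. 1) p) < 3"
    unfolding \<mu>_def INF_less_iff by auto
  have "awalk_cost (\<lambda>_. 1) p = real (length p)"
    by (simp add: awalk_cost_def sum_list_triv)
  with p(2) have "length p < 3"
    by (metis ereal_less(2) less_ereal.simps(1) numeral_eq_ereal of_nat_less_iff of_nat_numeral)
  then consider "p = []" | e where "p = [e]" | e f where "p = [e, f]"
    by (cases p rule: list.exhaust; cases "tl p" rule: list.exhaust; cases "tl (tl p)") auto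
  then show thesis
  proof cases
    case 1
    with p(1) assms(4) show thesis by (simp add: awalk_def)
  next
    case 2
    with p(1) assms(5) show thesis by (cases e) (auto simp: awalk_def nbrs_def)
  next
    case 3
    with p(1) have "fst f \<in> nbrs G u" "v \<in> nbrs G (fst f)"
      by (cases e; cases f; auto simp: awalk_def nbrs_def)+
    with that nbrs_sym show thesis by blast
  qed
qed

section \<open>Counting vertices and paths of two edges\<close>

lemma Moore_bound_diameter_two:
  assumes diam: "has_diameter_two (with_proj G)"
  shows "card (pverts G) \<le> 1 + (max_degree (with_proj G))\<^sup>2"
proof (cases "pverts G = {}")
  case False
  then obtain v where v: "v \<in> pverts G" by blast
  let ?\<Delta> = "max_degree (with_proj G)"
  \<comment> \<open>The part of the graph reached through a neighbour \<open>w\<close> of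
    \<open>v\<close>. Exchanging \<open>v\<close>, which is a neighbour of \<open>w\<close>, for
    \<open>w\<close> itself keeps the size at \<open>card (nbrs G w)\<close>, so the sets
    \<open>?B w\<close> and the single vertex \<open>v\<close> give exactly 1 + \<Delta> *
    \<Delta>.\<close>
  let ?B = "\<lambda>w. insert w (nbrs G w - {v})"
  have B: "card (?B w) \<le> ?\<Delta>" if "w \<in> nbrs G v" for w
  proof -
    have "v \<in> nbrs G w" "w \<in> pverts G"
      using that nbrs_sym nbrs_subset by blast+
    then have "Suc (card (nbrs G w - {v})) \<le> ?\<Delta>"
      using card_nbrs_le_max_degree finite_nbrs by (metis card_Suc_Diff1)
    then show ?thesis
      by (simp add: card_insert_if finite_nbrs)
  qed
  have "pverts G \<subseteq> insert v (\<Union>w\<in>nbrs G v. ?B w)"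
  proof
    fix u assume u: "u \<in> pverts G"
    show "u \<in> insert v (\<Union>w\<in>nbrs G v. ?B w)"
    proof (cases "u = v \<or> u \<in> nbrs G v")
      case False
      then obtain w where "w \<in> nbrs G v" "w \<in> nbrs G u"
        using obtain_common_nbr[OF diam v u] by blast
      then have "u \<in> ?B w" using False nbrs_sym by blast
      then show ?thesis using \<open>w \<in> nbrs G v\<close> by blast
    qed auto
  qed
  then have "card (pverts G) \<le> card (insert v (\<Union>w\<in>nbrs G v. ?B w))"
    using finite_nbrs by (intro card_mono) auto
  also have "\<dots> \<le> Suc (card (\<Union>w\<in>nbrs G v. ?B w))"
    by (simp add: card_insert_if finite_nbrs)
  also have "card (\<Union>w\<in>nbrs G v. ?B w) \<le> (\<Sum>w\<in>nbrs G v. card (?B w))"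
    using finite_nbrs by (rule card_UN_le)
  also have "\<dots> \<le> card (nbrs G v) * ?\<Delta>"
    using sum_bounded_above[of "nbrs G v", OF B] by simp
  also have "\<dots> \<le> ?\<Delta> * ?\<Delta>"
    using card_nbrs_le_max_degree[OF v] by simp
  finally show ?thesis
    by (simp add: power2_eq_square)
qed simp

text \<open>Double counting of the paths v - w - u with u \<noteq> v: each of the at least \<delta>
  middle vertices has at least \<delta> - 1 continuations, while each end vertex is reached through
  at most \<open>t - 1\<close> middle vertices.\<close>

lemma min_degree_path_count:
  assumes free: "subgraph_free (complete_bipartite_digraph 2 t) (with_proj G)"
    and "pverts G \<noteq> {}"
  shows "min_degree (with_proj G) * (min_degree (with_proj G) - 1) \<le> card (pverts G) * (t - 1)"
proof -
  obtain v where v: "v \<in> pverts G" using assms(2) by blast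
  let ?\<delta> = "min_degree (with_proj G)"
  \<comment> \<open>\<open>?P\<close> groups the paths by their middle vertex, \<open>?Q\<close> by
    their end vertex; swapping the pairs is a bijection between them.\<close>
  let ?P = "SIGMA w:nbrs G v. nbrs G w - {v}"
  let ?Q = "SIGMA u:pverts G - {v}. nbrs G u \<inter> nbrs G v"
  have low: "?\<delta> - 1 \<le> card (nbrs G w - {v})" if "w \<in> nbrs G v" for w
  proof -
    have "?\<delta> \<le> card (nbrs G w)"
      using that nbrs_subset by (intro min_degree_le_card_nbrs) blast
    then show ?thesis
      using that nbrs_sym by (simp add: card_Diff_singleton_if)
  qed
  have up: "card (nbrs G u \<inter> nbrs G v) \<le> t - 1" if "u \<in> pverts G - {v}" for u
    using card_common_nbrs_less[OF free, of u v] that v by auto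
  have "?P = prod.swap ` ?Q"
    using nbrs_sym nbrs_subset by (fastforce simp: image_iff)
  then have eq: "card ?P = card ?Q"
    by (simp add: card_image)
  have "?\<delta> * (?\<delta> - 1) \<le> card (nbrs G v) * (?\<delta> - 1)"
    using min_degree_le_card_nbrs[OF v] by simp
  also have "\<dots> \<le> (\<Sum>w\<in>nbrs G v. card (nbrs G w - {v}))"
    using sum_bounded_below[of "nbrs G v", OF low] by simp
  also have "\<dots> = card ?P"
    by (simp add: finite_nbrs)
  also have "\<dots> = (\<Sum>u\<in>pverts G - {v}. card (nbrs G u \<inter> nbrs G v))"
    unfolding eq by (simp add: finite_nbrs pair_finite_verts)
  also have "\<dots> \<le> card (pverts G - {v}) * (t - 1)"
    using sum_bounded_above[of "pverts G - {v}", OF up] by simp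
  also have "\<dots> \<le> card (pverts G) * (t - 1)"
    by (intro mult_right_mono card_mono pair_finite_verts) auto
  finally show ?thesis .
qed

section \<open>Comparing the degrees of two vertices\<close>

lemma card_nbrs_le_nonadjacent:
  assumes t: "t \<ge> 2"
    and tri: "subgraph_free (complete_digraph 3) (with_proj G)"
    and free: "subgraph_free (complete_bipartite_digraph 2 t) (with_proj G)"
    and diam: "has_diameter_two (with_proj G)"
    and uv: "u \<in> pverts G" "v \<in> pverts G" "u \<noteq> v" "v \<notin> nbrs G u"
  shows "card (nbrs G u) \<le> (t - 1) * card (nbrs G v)"
proof -
  \<comment> \<open>The neighbours of \<open>u\<close> charged to a neighbour \<open>x\<close> of
    \<open>v\<close>. A common neighbour \<open>x\<close> is charged to itself, which costs 1 \<le>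
    \<open>t - 1\<close> because \<open>t \<ge> 2\<close>; any other \<open>x\<close> differs from
    \<open>u\<close>, so it has at most \<open>t - 1\<close> neighbours in
    \<open>nbrs G u\<close>.\<close>
  let ?S = "\<lambda>x. if x \<in> nbrs G u then {x} else nbrs G u \<inter> nbrs G x"
  have S: "card (?S x) \<le> t - 1" if "x \<in> nbrs G v" for x
  proof (cases "x \<in> nbrs G u")
    case False
    have "x \<noteq> u" "x \<in> pverts G"
      using that uv nbrs_sym nbrs_subset by blast+
    then show ?thesis
      using False card_common_nbrs_less[OF free, of u x] uv by auto
  qed (use t in auto)
  have "nbrs G u \<subseteq> (\<Union>x\<in>nbrs G v. ?S x)"
  proof
    fix w assume w: "w \<in> nbrs G u"
    show "w \<in> (\<Union>x\<in>nbrs G v. ?S x)"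
    proof (cases "w \<in> nbrs G v")
      case True
      with w show ?thesis by auto
    next
      case False
      have "w \<noteq> v" "w \<in> pverts G" "v \<notin> nbrs G w"
        using w uv False nbrs_sym nbrs_subset by blast+
      then obtain x where x: "x \<in> nbrs G w" "x \<in> nbrs G v"
        using obtain_common_nbr[OF diam] uv by metis
      \<comment> \<open>Otherwise \<open>u\<close>, \<open>w\<close>, \<open>x\<close> form a
        triangle. Hence \<open>?S x\<close> is given by its second branch, which contains
        \<open>w\<close>.\<close>
      then have "x \<notin> nbrs G u"
        using not_triangle[OF tri w] by blast
      moreover have "w \<in> nbrs G x" using x nbrs_sym by blast
      ultimately show ?thesis using w x by auto
    qed
  qed
  then have "card (nbrs G u) \<le> card (\<Union>x\<in>nbrs G v. ?S x)"
    using finite_nbrs by (intro card_mono) auto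
  also have "\<dots> \<le> (\<Sum>x\<in>nbrs G v. card (?S x))"
    using finite_nbrs by (rule card_UN_le)
  also have "\<dots> \<le> card (nbrs G v) * (t - 1)"
    using sum_bounded_above[of "nbrs G v", OF S] by simp
  finally show ?thesis by (simp add: mult.commute)
qed

text \<open>Triangle-freeness makes the neighbours of \<open>v\<close> pairwise non-adjacent, so
  every edge contains \<open>v\<close>.\<close>

lemma star_graphI:
  assumes tri: "subgraph_free (complete_digraph 3) (with_proj G)"
    and v: "v \<in> pverts G" and nbrs: "nbrs G v = pverts G - {v}" "nbrs G v \<noteq> {}"
  shows "star_graph (with_proj G)"
proof -
  have indep: "b \<notin> nbrs G a" if "a \<in> nbrs G v" "b \<in> nbrs G v" for a b
    using not_triangle[OF tri] that by blast
  have "parcs G = {v} \<times> nbrs G v \<union> nbrs G v \<times> {v}"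
  proof (intro set_eqI iffI)
    fix e assume e: "e \<in> parcs G"
    obtain a b where [simp]: "e = (a, b)" by (cases e)
    have ab: "b \<in> nbrs G a" "a \<in> nbrs G b" using e nbrs_sym by (auto simp: nbrs_def)
    then have "a \<in> pverts G" "b \<in> pverts G" using nbrs_subset by blast+
    then show "e \<in> {v} \<times> nbrs G v \<union> nbrs G v \<times> {v}"
      using ab indep nbrs by auto
  next
    fix e assume "e \<in> {v} \<times> nbrs G v \<union> nbrs G v \<times> {v}"
    then show "e \<in> parcs G"
      using arcs_symmetric by (auto simp: nbrs_def)
  qed
  moreover have "pverts G = {v} \<union> nbrs G v" "{v} \<inter> nbrs G v = {}"
    using v nbrs(1) by auto
  moreover have "card {v} = 1" by simp
  ultimately have "complete_bipartite_digraph 1 (card (nbrs G v)) (with_proj G)"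
    unfolding complete_bipartite_digraph_pair_def using pair_finite_verts by metis
  moreover have "card (nbrs G v) \<ge> 1"
    using nbrs(2) finite_nbrs by (simp add: Suc_leI card_gt_0_iff)
  ultimately show ?thesis
    unfolding star_graph_def by blast
qed

text \<open>Such a graph is complete bipartite with parts \<open>nbrs G u\<close> and
  \<open>nbrs G v\<close>. Not being a star, it has at least two vertices in each part, and two
  vertices of one part have the whole other part as common neighbours, so both parts have size below
  \<open>t\<close>.\<close>

lemma card_verts_le_dominating_edge:
  assumes tri: "subgraph_free (complete_digraph 3) (with_proj G)"
    and free: "subgraph_free (complete_bipartite_digraph 2 t) (with_proj G)"
    and diam: "has_diameter_two (with_proj G)"
    and not_star: "\<not> star_graph (with_proj G)"
    and uv: "v \<in> nbrs G u"
    and dom: "pverts G \<subseteq> nbrs G u \<union> nbrs G v"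
  shows "card (pverts G) \<le> 2 * (t - 1)"
proof -
  have uv': "u \<in> nbrs G v" "u \<in> pverts G" "v \<in> pverts G"
    using uv nbrs_sym nbrs_subset by blast+
  \<comment> \<open>If \<open>y\<close> were the only neighbour of \<open>x\<close>, domination
    would make every vertex except \<open>y\<close> a neighbour of \<open>y\<close>, giving a star
    with centre \<open>y\<close>. The statement is for general \<open>x\<close>, \<open>y\<close> so
    that it serves both ends of the edge.\<close>
  have big: "\<exists>a \<in> nbrs G x. a \<noteq> y"
    if xy: "y \<in> nbrs G x" and dom_xy: "pverts G \<subseteq> nbrs G x \<union> nbrs G y" for x y
  proof (rule ccontr)
    assume "\<not> ?thesis"
    then have "nbrs G x = {y}" using xy by blast
    moreover have "x \<in> nbrs G y" "y \<in> pverts G" using xy nbrs_sym nbrs_subset by blast+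
    ultimately have "nbrs G y = pverts G - {y}" "nbrs G y \<noteq> {}"
      using dom_xy nbrs_subset[of y] nbrs_irrefl[of y] by auto
    then show False using star_graphI[OF tri \<open>y \<in> pverts G\<close>] not_star by blast
  qed
  \<comment> \<open>A common neighbour of non-adjacent \<open>a\<close> and \<open>b\<close> would be adjacent to \<open>u\<close> or \<open>v\<close>.\<close>
  have complete: "b \<in> nbrs G a" if "a \<in> nbrs G u" "b \<in> nbrs G v" for a b
  proof (rule ccontr)
    assume nb: "b \<notin> nbrs G a"
    have ab: "a \<in> pverts G" "b \<in> pverts G" using that nbrs_subset by blast+
    have "a \<noteq> b" using not_triangle[OF tri uv] that by blast
    then obtain x where x: "x \<in> nbrs G a" "x \<in> nbrs G b"
      using obtain_common_nbr[OF diam ab _ nb] by blast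
    then have "x \<in> nbrs G u \<or> x \<in> nbrs G v" using dom nbrs_subset by blast
    then show False using not_triangle[OF tri] that x by blast
  qed
  obtain a where a: "a \<in> nbrs G u" "a \<noteq> v" using big uv dom by blast
  obtain b where b: "b \<in> nbrs G v" "b \<noteq> u" using big[OF uv'(1)] dom by blast
  have ab: "a \<in> pverts G" "b \<in> pverts G" using a b nbrs_subset by blast+
  \<comment> \<open>The second vertex \<open>b\<close> in the part of \<open>u\<close> is adjacent
    to all of \<open>nbrs G u\<close>, so the bound on common neighbours of \<open>u\<close> and
    \<open>b\<close> bounds the degree of \<open>u\<close>.\<close>
  have "nbrs G u \<subseteq> nbrs G u \<inter> nbrs G b"
    using complete b nbrs_sym by blast
  then have "card (nbrs G u) < t"
    using card_common_nbrs_less[OF free, of u b] b uv' ab by (simp add: Int_absorb2)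
  moreover have "nbrs G v \<subseteq> nbrs G v \<inter> nbrs G a"
    using complete a by blast
  then have "card (nbrs G v) < t"
    using card_common_nbrs_less[OF free, of v a] a uv' ab by (simp add: Int_absorb2)
  moreover have "card (pverts G) \<le> card (nbrs G u \<union> nbrs G v)"
    using dom finite_nbrs by (intro card_mono) auto
  moreover have "\<dots> \<le> card (nbrs G u) + card (nbrs G v)"
    by (rule card_Un_le)
  ultimately show ?thesis by linarith
qed

lemma max_degree_le_min_degree:
  assumes t: "t \<ge> 2"
    and tri: "subgraph_free (complete_digraph 3) (with_proj G)"
    and free: "subgraph_free (complete_bipartite_digraph 2 t) (with_proj G)"
    and diam: "has_diameter_two (with_proj G)"
    and not_star: "\<not> star_graph (with_proj G)"
    and large: "card (pverts G) > 2 * (t - 1)"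
  shows "max_degree (with_proj G) \<le> (t - 1)\<^sup>2 * min_degree (with_proj G)"
proof -
  have "pverts G \<noteq> {}" using large by auto
  then obtain u v where
    u: "u \<in> pverts G" "card (nbrs G u) = max_degree (with_proj G)" and
    v: "v \<in> pverts G" "card (nbrs G v) = min_degree (with_proj G)"
    using obtain_max_degree_vertex obtain_min_degree_vertex by metis
  note step = card_nbrs_le_nonadjacent[OF t tri free diam]
  \<comment> \<open>For equal or non-adjacent \<open>u\<close>, \<open>v\<close> the factor is 1 or
    \<open>t - 1\<close>; as 1 \<le> \<open>t - 1\<close>, both are at most
    \<open>(t - 1)\<^sup>2\<close>.\<close>
  have le_sq: "(t - 1) * k \<le> (t - 1)\<^sup>2 * k" "k \<le> (t - 1)\<^sup>2 * k" for k
  proof -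
    have "1 \<le> t - 1" using t by simp
    then show "(t - 1) * k \<le> (t - 1)\<^sup>2 * k" "k \<le> (t - 1)\<^sup>2 * k"
      by (simp_all add: power2_eq_square)
  qed
  have "card (nbrs G u) \<le> (t - 1)\<^sup>2 * card (nbrs G v)"
  proof -
    consider "u = v" | "u \<noteq> v" "v \<notin> nbrs G u" | "v \<in> nbrs G u" by blast
    then show ?thesis
    proof cases
      case 1
      then show ?thesis using le_sq(2) by simp
    next
      case 2
      then show ?thesis using step[OF u(1) v(1)] le_sq(1) le_trans by blast
    next
      case 3
      \<comment> \<open>The size assumption excludes a dominating edge. The vertex \<open>w\<close>
        missed by the edge differs from both ends, so the non-adjacent case applies to
        \<open>u\<close>, \<open>w\<close> and to \<open>w\<close>, \<open>v\<close>.\<close>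
      then obtain w where w: "w \<in> pverts G" "w \<notin> nbrs G u" "w \<notin> nbrs G v"
        using card_verts_le_dominating_edge[OF tri free diam not_star 3] large by fastforce
      have "w \<noteq> u" "w \<noteq> v" "v \<notin> nbrs G w" using 3 w nbrs_sym by blast+
      then have "card (nbrs G u) \<le> (t - 1) * card (nbrs G w)"
        "card (nbrs G w) \<le> (t - 1) * card (nbrs G v)"
        using step u v w by metis+
      then have "card (nbrs G u) \<le> (t - 1) * ((t - 1) * card (nbrs G v))"
        by (meson le_trans mult_le_mono2)
      then show ?thesis by (simp add: power2_eq_square mult.assoc)
    qed
  qed
  then show ?thesis using u v by simp
qed

end

section \<open>Elementary estimates with square roots\<close>

lemma sqrt_diff_one_ge:
  fixes \<epsilon> x :: real
  assumes "\<epsilon> > 0" "x \<ge> 1" "x \<ge> 1 / \<epsilon>"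
  shows "(1 - \<epsilon>) * sqrt x \<le> sqrt (x - 1)"
proof (cases "\<epsilon> \<le> 1")
  case True
  have "(1 - \<epsilon>)\<^sup>2 * x \<le> (1 - \<epsilon>) * x"
    using True assms by (intro mult_right_mono) (auto simp: power2_eq_square mult_left_le)
  also have "\<dots> \<le> x - 1"
    using assms by (simp add: field_simps)
  finally have "sqrt ((1 - \<epsilon>)\<^sup>2 * x) \<le> sqrt (x - 1)" by simp
  then show ?thesis using True by (simp add: real_sqrt_mult)
next
  case False
  then have "(1 - \<epsilon>) * sqrt x \<le> 0"
    using assms by (intro mult_nonpos_nonneg) auto
  also have "0 \<le> sqrt (x - 1)" using assms by simp
  finally show ?thesis .
qed

text \<open>The product \<open>k * (k - 1)\<close> dominates \<open>(k - 1)\<^sup>2\<close>. The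
  case \<open>k = 0\<close> is separate because of truncated subtraction.\<close>

lemma le_one_plus_sqrt:
  fixes k m :: nat
  assumes "k * (k - 1) \<le> m"
  shows "real k \<le> 1 + sqrt (real m)"
proof (cases "k = 0")
  case False
  have "(k - 1)\<^sup>2 \<le> m"
    using assms by (metis diff_le_self le_trans mult_le_mono1 power2_eq_square)
  then have "(real (k - 1))\<^sup>2 \<le> real m"
    by (metis of_nat_le_iff of_nat_power)
  then have "(real k - 1)\<^sup>2 \<le> real m"
    using False by (simp add: of_nat_diff)
  then show ?thesis
    using real_le_rsqrt[of "real k - 1" "real m"] by linarith
qed simp

section \<open>The degree bounds, with an explicit threshold for the asymptotic ones\<close>

theorem proposition4:
  fixes t :: nat
  assumes "t \<ge> 2"
  shows "(\<forall>\<epsilon>::real. \<epsilon> > 0 \<longrightarrow> (\<exists>N::nat. \<forall>G :: 'a pair_pre_digraph.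
           pair_graph G \<and>
           subgraph_free (complete_digraph 3) (with_proj G) \<and>
           subgraph_free (complete_bipartite_digraph 2 t) (with_proj G) \<and>
           has_diameter_two (with_proj G) \<and>
           \<not> star_graph (with_proj G) \<and>
           card (pverts G) \<ge> N
           \<longrightarrow> real (min_degree (with_proj G))
                 \<ge> (1 - \<epsilon>) * (1 / (real t - 1)\<^sup>2) * sqrt (real (card (pverts G))) \<and>
               real (min_degree (with_proj G))
                 \<le> (1 + \<epsilon>) * sqrt (real t * real (card (pverts G))))) \<and>
         (\<forall>G :: 'a pair_pre_digraph.
           pair_graph G \<and>
           subgraph_free (complete_digraph 3) (with_proj G) \<and>
           subgraph_free (complete_bipartite_digraph 2 t) (with_proj G) \<and>
           has_diameter_two (with_proj G) \<and>
           \<not> star_graph (with_proj G)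
           \<longrightarrow> real (max_degree (with_proj G)) \<ge> sqrt (real (card (pverts G)) - 1))"
proof (intro conjI allI impI; (elim conjE)?)
  fix G :: "'a pair_pre_digraph"
  assume "pair_graph G" and diam: "has_diameter_two (with_proj G)"
  then interpret pair_graph G by simp
  have "real (card (pverts G)) - 1 \<le> (real (max_degree (with_proj G)))\<^sup>2"
    using Moore_bound_diameter_two[OF diam] by (simp flip: of_nat_power)
  then show "real (max_degree (with_proj G)) \<ge> sqrt (real (card (pverts G)) - 1)"
    by (intro real_le_lsqrt) auto
next
  fix \<epsilon> :: real
  assume \<epsilon>: "\<epsilon> > 0"
  \<comment> \<open>The summand 2t puts n above 2(t - 1) for the degree comparison, 1/\<epsilon>
    pays for passing from sqrt(n - 1) to sqrt n, and 1/\<epsilon>^2 absorbs the additive 1 of the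
    path count. The threshold depends on \<open>t\<close> and \<epsilon> only, which gives
    uniformity.\<close>
  let ?N = "2 * t + nat \<lceil>1 / \<epsilon>\<rceil> + nat \<lceil>1 / \<epsilon>\<^sup>2\<rceil>"
  show "\<exists>N::nat. \<forall>G :: 'a pair_pre_digraph.
           pair_graph G \<and>
           subgraph_free (complete_digraph 3) (with_proj G) \<and>
           subgraph_free (complete_bipartite_digraph 2 t) (with_proj G) \<and>
           has_diameter_two (with_proj G) \<and>
           \<not> star_graph (with_proj G) \<and>
           card (pverts G) \<ge> N
           \<longrightarrow> real (min_degree (with_proj G))
                 \<ge> (1 - \<epsilon>) * (1 / (real t - 1)\<^sup>2) * sqrt (real (card (pverts G))) \<and>
               real (min_degree (with_proj G))
                 \<le> (1 + \<epsilon>) * sqrt (real t * real (card (pverts G)))"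
  proof (intro exI[of _ ?N] allI impI, elim conjE)
    fix G :: "'a pair_pre_digraph"
    assume "pair_graph G"
      and tri: "subgraph_free (complete_digraph 3) (with_proj G)"
      and free: "subgraph_free (complete_bipartite_digraph 2 t) (with_proj G)"
      and diam: "has_diameter_two (with_proj G)"
      and not_star: "\<not> star_graph (with_proj G)"
      and N: "card (pverts G) \<ge> ?N"
    then interpret pair_graph G by simp
    let ?n = "real (card (pverts G))"
    let ?\<delta> = "real (min_degree (with_proj G))" and ?\<Delta> = "real (max_degree (with_proj G))"
    have large: "card (pverts G) > 2 * (t - 1)" "?n \<ge> 1" "?n \<ge> 1 / \<epsilon>" "?n \<ge> 1 / \<epsilon>\<^sup>2"
      using N assms by linarith+
    have "?n - 1 \<le> ?\<Delta>\<^sup>2"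
      using Moore_bound_diameter_two[OF diam] by (simp flip: of_nat_power)
    then have "sqrt (?n - 1) \<le> ?\<Delta>"
      by (intro real_le_lsqrt) auto
    moreover have "?\<Delta> \<le> real ((t - 1)\<^sup>2 * min_degree (with_proj G))"
      using max_degree_le_min_degree[OF assms tri free diam not_star large(1)]
      by (simp only: of_nat_le_iff)
    moreover have "(1 - \<epsilon>) * sqrt ?n \<le> sqrt (?n - 1)"
      using sqrt_diff_one_ge[OF \<epsilon> large(2,3)] .
    \<comment> \<open>The chain is (1 - \<epsilon>) sqrt n \<le> sqrt(n - 1) \<le> \<Delta> \<le> (t
      - 1)^2 \<delta>.\<close>
    ultimately have "(1 - \<epsilon>) * sqrt ?n \<le> (real t - 1)\<^sup>2 * ?\<delta>"
      using assms by (simp add: of_nat_diff)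
    then have lower: "(1 - \<epsilon>) * (1 / (real t - 1)\<^sup>2) * sqrt ?n \<le> ?\<delta>"
      using assms by (simp add: divide_le_eq mult.commute)
    \<comment> \<open>Since tn \<ge> n \<ge> 1/\<epsilon>^2, the additive 1 is at most \<epsilon>
      sqrt(tn).\<close>
    have "1 / \<epsilon> = sqrt (1 / \<epsilon>\<^sup>2)"
      using \<epsilon> by (simp add: real_sqrt_divide)
    also have "\<dots> \<le> sqrt (real t * ?n)"
    proof -
      have "1 * ?n \<le> real t * ?n" using assms by (intro mult_right_mono) auto
      then show ?thesis using large(4) by simp
    qed
    finally have "1 \<le> \<epsilon> * sqrt (real t * ?n)"
      using \<epsilon> by (simp add: field_simps)
    moreover have "?\<delta> \<le> 1 + sqrt (real (card (pverts G) * (t - 1)))"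
    proof (intro le_one_plus_sqrt min_degree_path_count[OF free])
      show "pverts G \<noteq> {}" using large(2) by auto
    qed
    moreover have "sqrt (real (card (pverts G) * (t - 1))) \<le> sqrt (real t * ?n)"
      using assms by (simp add: of_nat_diff mult.commute mult_right_mono)
    ultimately have "?\<delta> \<le> (1 + \<epsilon>) * sqrt (real t * ?n)"
      unfolding distrib_right mult_1_left by linarith
    with lower show "(1 - \<epsilon>) * (1 / (real t - 1)\<^sup>2) * sqrt ?n \<le> ?\<delta> \<and>
        ?\<delta> \<le> (1 + \<epsilon>) * sqrt (real t * ?n)" by blast
  qed
qed

end
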